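(* Let $V$ be a set of agents, $A=\{a,b\}$ with $a\neq b$, and let $\mathcal P\subseteq\mathcal W(A)^V$ be a quasi-cartesian restricted domain. Let $\chi_{bi}:\mathcal P\to\mathcal V$ be the function $\chi_{bi}(P)=\big(D(a,P),\,D(a,P)\cup I(P)\big)$. Then the set of all weakly group strategy-proof social choice functions $\phi:\mathcal P\to\{a,b\}$ consists of all and only the functions $\phi_{(\chi_{bi},C)}$, with $C$ a super order closed (SOC) subset of the poset $\big(\chi_{bi}(\mathcal P),\le_{\mathcal V}\big)$ of veto pairs, where $\phi_{(\chi_{bi},C)}(P)=a\iff\chi_{bi}(P)\in C$ (and $=b$ otherwise).
   Context: $V$ is an arbitrary set (possibly infinite). $\mathcal W(A)$ is the set of all complete, transitive binary relations (preferences) on $A$. For $W\in\mathcal W(A)$: $x\succ_W y$ means $(x,y)\in W$ and $(y,x)\notin W$; $x\sim_W y$ means both $(x,y),(y,x)\in W$. A profile is a function $P=(P_v)_{v\in V}$ from $V$ to $\mathcal W(A)$. $\mathcal P$ is a quasi-cartesian restricted domain if for all $P,Q\in\mathcal P$ and $T\subseteq V$ the profile $[P_T,Q_{T^c}]$ (equal to $P$ on $T$ and to $Q$ on $T^c=V\setminus T$) belongs to $\mathcal P$. A social choice function $\phi:\mathcal P\to A$ is weakly group strategy-proof if there are no nonempty $D\subseteq V$ and $P,Q\in\mathcal P$ such that $P_v=Q_v$ for all $v\in V\setminus D$ and $\phi(Q)\succ_{P_v}\phi(P)$ for all $v\in D$. $D(a,P)=\{v\in V: a\succ_{P_v} b\}$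 and $I(P)=\{v\in V: a\sim_{P_v} b\}$. $\mathcal V=\{(S,W)\in 2^V\times 2^V: S\subseteq W\}$ is the set of veto pairs, partially ordered by componentwise inclusion: $(S,W)\le_{\mathcal V}(S',W')$ iff $S\subseteq S'$ and $W\subseteq W'$. $\chi_{bi}(\mathcal P)$ is the image of $\chi_{bi}$, with the restricted order. A subset $C$ of a poset $(M,\ge)$ is super order closed (SOC) if $x\in M$, $f\in C$, $x\ge f$ imply $x\in C$ (the empty set is SOC). *)

theory Defs
  imports Main "HOL-Library.FuncSet" "HOL-Library.Product_Order"
begin

text \<open>
  Completeness includes the case \<open>x = y\<close>, so preferences are reflexive on \<open>A\<close>.
\<close>

definition preferences :: "'a set \<Rightarrow> ('a \<times> 'a) set set" where
  "preferences A =
     {W. W \<subseteq> A \<times> A \<and> (\<forall>x\<in>A. \<forall>y\<in>A. (x, y) \<in> W \<or> (y, x) \<in> W) \<and> trans W}"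

definition strictly_prefers :: "('a \<times> 'a) set \<Rightarrow> 'a \<Rightarrow> 'a \<Rightarrow> bool" where
  "strictly_prefers W x y \<longleftrightarrow> (x, y) \<in> W \<and> (y, x) \<notin> W"

definition indifferent :: "('a \<times> 'a) set \<Rightarrow> 'a \<Rightarrow> 'a \<Rightarrow> bool" where
  "indifferent W x y \<longleftrightarrow> (x, y) \<in> W \<and> (y, x) \<in> W"

text \<open>
  Functions with a given domain are extensional, i.e. \<open>undefined\<close> outside it, so that
  equality in HOL is equality of functions on the domain: this concerns profiles (domain \<open>V\<close>)
  and social choice functions (domain \<open>\<P>\<close>).
\<close>

type_synonym ('v, 'a) profile = "'v \<Rightarrow> ('a \<times> 'a) set"

definition profiles :: "'v set \<Rightarrow> 'a set \<Rightarrow> ('v, 'a) profile set" where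
  "profiles V A = V \<rightarrow>\<^sub>E preferences A"

text \<open>
  \<open>override_on Q P T\<close> is the profile equal to \<open>P\<close> on \<open>T\<close> and to \<open>Q\<close> on the complement.
\<close>

definition quasi_cartesian :: "'v set \<Rightarrow> 'a set \<Rightarrow> ('v, 'a) profile set \<Rightarrow> bool" where
  "quasi_cartesian V A \<P> \<longleftrightarrow>
     \<P> \<subseteq> profiles V A \<and> (\<forall>P\<in>\<P>. \<forall>Q\<in>\<P>. \<forall>T. T \<subseteq> V \<longrightarrow> override_on Q P T \<in> \<P>)"

definition social_choice_functions ::
    "('v, 'a) profile set \<Rightarrow> 'a set \<Rightarrow> (('v, 'a) profile \<Rightarrow> 'a) set" where
  "social_choice_functions \<P> A = \<P> \<rightarrow>\<^sub>E A"

definition weakly_group_strategy_proof ::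
    "'v set \<Rightarrow> ('v, 'a) profile set \<Rightarrow> (('v, 'a) profile \<Rightarrow> 'a) \<Rightarrow> bool" where
  "weakly_group_strategy_proof V \<P> \<phi> \<longleftrightarrow>
     \<not> (\<exists>D P Q. D \<noteq> {} \<and> D \<subseteq> V \<and> P \<in> \<P> \<and> Q \<in> \<P> \<and>
          (\<forall>v\<in>V - D. P v = Q v) \<and>
          (\<forall>v\<in>D. strictly_prefers (P v) (\<phi> Q) (\<phi> P)))"

definition supporters :: "'v set \<Rightarrow> 'a \<Rightarrow> 'a \<Rightarrow> ('v, 'a) profile \<Rightarrow> 'v set" where
  "supporters V a b P = {v \<in> V. strictly_prefers (P v) a b}"

definition indifferents :: "'v set \<Rightarrow> 'a \<Rightarrow> 'a \<Rightarrow> ('v, 'a) profile \<Rightarrow> 'v set" where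
  "indifferents V a b P = {v \<in> V. indifferent (P v) a b}"

definition veto_pairs :: "'v set \<Rightarrow> ('v set \<times> 'v set) set" where
  "veto_pairs V = {(S, W). S \<subseteq> V \<and> W \<subseteq> V \<and> S \<subseteq> W}"

definition chi_bi :: "'v set \<Rightarrow> 'a \<Rightarrow> 'a \<Rightarrow> ('v, 'a) profile \<Rightarrow> 'v set \<times> 'v set" where
  "chi_bi V a b P = (supporters V a b P, supporters V a b P \<union> indifferents V a b P)"

lemma chi_bi_in_veto_pairs: "chi_bi V a b \<in> \<P> \<rightarrow> veto_pairs V"
  by (auto simp: chi_bi_def veto_pairs_def supporters_def indifferents_def)

text \<open>
  The poset is the set \<open>M\<close> with the order of its type. On pairs of sets this is the
  componentwise inclusion of \<^theory>\<open>HOL-Library.Product_Order\<close>.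
\<close>

lemma veto_order_iff:
  fixes S S' W W' :: "'v set"
  shows "(S, W) \<le> (S', W') \<longleftrightarrow> S \<subseteq> S' \<and> W \<subseteq> W'"
  by simp

definition super_order_closed :: "'m::order set \<Rightarrow> 'm set \<Rightarrow> bool" where
  "super_order_closed M C \<longleftrightarrow> C \<subseteq> M \<and> (\<forall>x\<in>M. \<forall>f\<in>C. f \<le> x \<longrightarrow> x \<in> C)"

definition phi_of ::
    "('v, 'a) profile set \<Rightarrow> 'a \<Rightarrow> 'a \<Rightarrow> (('v, 'a) profile \<Rightarrow> 'm) \<Rightarrow> 'm set \<Rightarrow>
     ('v, 'a) profile \<Rightarrow> 'a" where
  "phi_of \<P> a b \<chi> C = (\<lambda>P\<in>\<P>. if \<chi> P \<in> C then a else b)"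

end

theory Submission
  imports Defs
begin

text \<open>
  With two alternatives a preference is determined by whether an agent favours \<open>a\<close>, favours \<open>b\<close>
  or is indifferent, so both conditions say that \<open>\<phi>\<close> is monotone along \<open>chi_bi\<close>. To get from
  \<open>P\<close> with outcome \<open>a\<close> to a larger \<open>Q\<close>, first switch to \<open>Q\<close> the agents that favour \<open>b\<close> at \<open>P\<close>: an
  outcome \<open>b\<close> would be a manipulation by them at \<open>P\<close>. The intermediate profile then differs
  from \<open>Q\<close> only on agents that favour \<open>a\<close> at \<open>Q\<close>, so outcome \<open>b\<close> at \<open>Q\<close> would be a manipulation
  by those at \<open>Q\<close>. Conversely, a successful manipulation moves the outcome against the order,
  because members of the deviating coalition all sit at the same extreme at \<open>P\<close>.
\<close>

lemma profile_preference:
  assumes "quasi_cartesian V A \<P>" "P \<in> \<P>" "v \<in> V"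
  shows "P v \<in> preferences A"
  using assms by (auto simp: quasi_cartesian_def profiles_def)

lemma profile_eqI:
  assumes "quasi_cartesian V A \<P>" "P \<in> \<P>" "Q \<in> \<P>" "\<And>v. v \<in> V \<Longrightarrow> P v = Q v"
  shows "P = Q"
proof -
  have "P \<in> V \<rightarrow>\<^sub>E preferences A" "Q \<in> V \<rightarrow>\<^sub>E preferences A"
    using assms(1-3) by (auto simp: quasi_cartesian_def profiles_def)
  then show ?thesis by (rule PiE_ext) (rule assms(4))
qed

lemma preference_cases:
  assumes "W \<in> preferences {a, b}"
  shows "strictly_prefers W a b \<or> indifferent W a b \<or> strictly_prefers W b a"
  using assms by (auto simp: preferences_def strictly_prefers_def indifferent_def)

text \<open>Completeness forces the reflexive pairs, so indifference leaves only the full relation.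
  Hence an agent indifferent in two profiles need not be counted among the deviators between
  them.\<close>

lemma indifferent_preferences_eq:
  assumes "W \<in> preferences {a, b}" "W' \<in> preferences {a, b}"
    and "indifferent W a b" "indifferent W' a b"
  shows "W = W'"
proof -
  have "W = {a, b} \<times> {a, b}" if "W \<in> preferences {a, b}" "indifferent W a b" for W
    using that by (auto simp: preferences_def indifferent_def)
  from this[OF assms(1,3)] this[OF assms(2,4)] show ?thesis by (rule trans[OF _ sym])
qed

text \<open>The second component collects the agents with \<open>(a, b)\<close> in their preference,
  so the veto order compares agent by agent.\<close>

lemma chi_bi_le_iff:
  "chi_bi V a b P \<le> chi_bi V a b Q \<longleftrightarrow>
     (\<forall>v\<in>V. (strictly_prefers (P v) a b \<longrightarrow> strictly_prefers (Q v) a b) \<and>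
            ((a, b) \<in> P v \<longrightarrow> (a, b) \<in> Q v))"
  by (auto simp: chi_bi_def supporters_def indifferents_def strictly_prefers_def indifferent_def)

lemma weakly_group_strategy_proofD:
  assumes "weakly_group_strategy_proof V \<P> \<phi>" "D \<noteq> {}" "D \<subseteq> V" "P \<in> \<P>" "Q \<in> \<P>"
    and "\<And>v. v \<in> V - D \<Longrightarrow> P v = Q v"
    and "\<And>v. v \<in> D \<Longrightarrow> strictly_prefers (P v) (\<phi> Q) (\<phi> P)"
  shows False
  using assms(1) unfolding weakly_group_strategy_proof_def
  by (rule notE) (intro exI[of _ D] exI[of _ P] exI[of _ Q] conjI ballI assms(2-))

lemma weakly_group_strategy_proof_mono:
  assumes qc: "quasi_cartesian V {a, b} \<P>"
    and \<phi>: "\<phi> \<in> \<P> \<rightarrow> {a, b}" and wgsp: "weakly_group_strategy_proof V \<P> \<phi>"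
    and P: "P \<in> \<P>" and Q: "Q \<in> \<P>" and le: "chi_bi V a b P \<le> chi_bi V a b Q"
    and Pa: "\<phi> P = a"
  shows "\<phi> Q = a"
proof (rule ccontr)
  assume "\<phi> Q \<noteq> a"
  then have Qb: "\<phi> Q = b" and ab: "a \<noteq> b" using \<phi> Q by auto
  define D\<^sub>P where "D\<^sub>P = {v \<in> V. strictly_prefers (P v) b a}"
  define D\<^sub>Q where "D\<^sub>Q = {v \<in> V. strictly_prefers (Q v) a b}"
  define R where "R = override_on P Q D\<^sub>P"
  have R: "R \<in> \<P>"
  proof -
    have "D\<^sub>P \<subseteq> V" by (auto simp: D\<^sub>P_def)
    with qc P Q show ?thesis unfolding R_def quasi_cartesian_def by simp
  qed
  have Ra: "\<phi> R = a"
  proof (rule ccontr)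
    assume "\<phi> R \<noteq> a"
    then have Rb: "\<phi> R = b" using \<phi> R by auto
    \<comment> \<open>With no agent favouring \<open>b\<close> at \<open>P\<close>, \<open>R\<close>
      would be \<open>P\<close>, whose outcome is \<open>a\<close>.\<close>
    then have "D\<^sub>P \<noteq> {}" using Pa ab by (auto simp: R_def)
    then show False
      by (rule weakly_group_strategy_proofD[OF wgsp _ _ P R])
        (simp_all add: Pa Rb, simp_all add: R_def D\<^sub>P_def)
  qed
  have agree: "Q v = R v" if "v \<in> V - D\<^sub>Q" for v
  proof (cases "v \<in> D\<^sub>P")
    case False
    have pref: "P v \<in> preferences {a, b}" "Q v \<in> preferences {a, b}"
      using profile_preference[OF qc] P Q that by auto
    \<comment> \<open>Strictly favouring \<open>a\<close> at \<open>P\<close> would persist at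
      \<open>Q\<close> by \<open>le\<close> and put \<open>v\<close> in \<open>D\<^sub>Q\<close>;
      strictly favouring \<open>b\<close> would put it in \<open>D\<^sub>P\<close>.\<close>
    have "indifferent (P v) a b"
      using preference_cases[OF pref(1)] False that le
      by (auto simp: chi_bi_le_iff D\<^sub>P_def D\<^sub>Q_def)
    moreover from this have "indifferent (Q v) a b"
      using that le by (auto simp: chi_bi_le_iff D\<^sub>Q_def indifferent_def strictly_prefers_def)
    ultimately show ?thesis
      using indifferent_preferences_eq[OF pref] False by (simp add: R_def)
  qed (simp add: R_def)
  \<comment> \<open>Otherwise \<open>Q\<close> and \<open>R\<close> agree on all of \<open>V\<close>
    and coincide, although their outcomes differ.\<close>
  have "D\<^sub>Q \<noteq> {}"
    using profile_eqI[OF qc Q R] agree Ra Qb ab by auto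
  then show False
    by (rule weakly_group_strategy_proofD[OF wgsp _ _ Q R])
      (erule agree | simp add: D\<^sub>Q_def Ra Qb)+
qed

lemma weakly_group_strategy_proof_phi_of:
  assumes "a \<noteq> b" and soc: "super_order_closed (chi_bi V a b ` \<P>) C"
  shows "weakly_group_strategy_proof V \<P> (phi_of \<P> a b (chi_bi V a b) C)"
    (is "weakly_group_strategy_proof V \<P> ?\<phi>")
  unfolding weakly_group_strategy_proof_def
proof (intro notI, elim exE conjE)
  fix D P Q
  assume D: "D \<noteq> {}" "D \<subseteq> V" and P: "P \<in> \<P>" and Q: "Q \<in> \<P>"
    and eq: "\<forall>v\<in>V - D. P v = Q v"
    and gain: "\<forall>v\<in>D. strictly_prefers (P v) (?\<phi> Q) (?\<phi> P)"
  have up: "Q' \<in> \<P> \<Longrightarrow> chi_bi V a b P' \<le> chi_bi V a b Q' \<Longrightarrow> chi_bi V a b P' \<in> C \<Longrightarrow>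
      chi_bi V a b Q' \<in> C" for P' Q'
    using soc unfolding super_order_closed_def by blast
  have val: "?\<phi> R = (if chi_bi V a b R \<in> C then a else b)" if "R \<in> \<P>" for R
    using that by (simp add: phi_of_def)
  have "?\<phi> Q \<noteq> ?\<phi> P" using D(1) gain by (auto simp: strictly_prefers_def)
  then consider
      "chi_bi V a b Q \<in> C" "chi_bi V a b P \<notin> C" "\<forall>v\<in>D. strictly_prefers (P v) a b"
    | "chi_bi V a b Q \<notin> C" "chi_bi V a b P \<in> C" "\<forall>v\<in>D. strictly_prefers (P v) b a"
    using gain by (auto simp: val P Q split: if_splits)
  then show False
  proof cases
    case 1
    \<comment> \<open>At \<open>P\<close> every member of \<open>D\<close> is at the top of the
      order, so any deviation moves down; the other agents do not move. In the second case the
      members are at the bottom.\<close>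
    have "chi_bi V a b Q \<le> chi_bi V a b P"
      using 1(3) eq unfolding chi_bi_le_iff strictly_prefers_def by (metis DiffI)
    then show False using up[OF P] 1 by blast
  next
    case 2
    have "chi_bi V a b P \<le> chi_bi V a b Q"
      using 2(3) eq unfolding chi_bi_le_iff strictly_prefers_def by (metis DiffI)
    then show False using up[OF Q] 2 by blast
  qed
qed

theorem theorem5p2:
  fixes V :: "'v set" and a b :: 'a and \<P> :: "('v, 'a) profile set"
  assumes "a \<noteq> b"
    and "quasi_cartesian V {a, b} \<P>"
  shows "{\<phi> \<in> social_choice_functions \<P> {a, b}. weakly_group_strategy_proof V \<P> \<phi>} =
         {phi_of \<P> a b (chi_bi V a b) C | C. super_order_closed (chi_bi V a b ` \<P>) C}"
proof (intro equalityI subsetI)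
  fix \<phi>
  assume "\<phi> \<in> {\<phi> \<in> social_choice_functions \<P> {a, b}. weakly_group_strategy_proof V \<P> \<phi>}"
  then have \<phi>: "\<phi> \<in> \<P> \<rightarrow>\<^sub>E {a, b}" and wgsp: "weakly_group_strategy_proof V \<P> \<phi>"
    by (auto simp: social_choice_functions_def)
  have "\<phi> \<in> \<P> \<rightarrow> {a, b}" using \<phi> by auto
  note mono = weakly_group_strategy_proof_mono[OF assms(2) this wgsp]
  define C where "C = chi_bi V a b ` {P \<in> \<P>. \<phi> P = a}"
  \<comment> \<open>Profiles with the same veto pair are comparable both ways, so monotonicity makes
    \<open>\<phi>\<close> constant on the fibres of \<open>chi_bi\<close>.\<close>
  have C_iff: "chi_bi V a b P \<in> C \<longleftrightarrow> \<phi> P = a" if "P \<in> \<P>" for P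
  proof
    assume "chi_bi V a b P \<in> C"
    then obtain P' where "P' \<in> \<P>" "chi_bi V a b P = chi_bi V a b P'" "\<phi> P' = a"
      unfolding C_def by blast
    then show "\<phi> P = a" using mono[of P' P] that by simp
  qed (use that in \<open>auto simp: C_def\<close>)
  have "super_order_closed (chi_bi V a b ` \<P>) C"
    unfolding super_order_closed_def
  proof (intro conjI ballI impI)
    show "C \<subseteq> chi_bi V a b ` \<P>" by (auto simp: C_def)
    fix x f assume "x \<in> chi_bi V a b ` \<P>" "f \<in> C" "f \<le> x"
    then show "x \<in> C" using mono unfolding C_def by blast
  qed
  moreover have "\<phi> = phi_of \<P> a b (chi_bi V a b) C"
  proof
    \<comment> \<open>Outside \<open>\<P>\<close> both functions are \<open>undefined\<close> by
      extensionality.\<close>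
    fix P show "\<phi> P = phi_of \<P> a b (chi_bi V a b) C P"
      using \<phi> C_iff[of P] by (cases "P \<in> \<P>") (auto simp: phi_of_def)
  qed
  ultimately show "\<phi> \<in> {phi_of \<P> a b (chi_bi V a b) C | C.
      super_order_closed (chi_bi V a b ` \<P>) C}"
    by blast
next
  fix \<phi>
  assume "\<phi> \<in> {phi_of \<P> a b (chi_bi V a b) C | C. super_order_closed (chi_bi V a b ` \<P>) C}"
  then show "\<phi> \<in> {\<phi> \<in> social_choice_functions \<P> {a, b}. weakly_group_strategy_proof V \<P> \<phi>}"
    using weakly_group_strategy_proof_phi_of[OF assms(1)]
    by (auto simp: social_choice_functions_def phi_of_def)
qed

end
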